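(* Let $q:\mathbb{R}\to\mathbb{C}$ be a $2\pi$-periodic complex-valued function of class $C^2$, and let $H=-\frac{d^2}{dx^2}+q(x)$ be the associated Hill operator acting in $L^2(\mathbb{R})$. Suppose that the spectrum of $H$ is $\sigma(H)=[0,\infty)$ (thus its Hill discriminant is $\Delta(\lambda)=2\cos(2\pi\sqrt{\lambda})$). Furthermore, suppose that for every integer $n\ge 1$ there is coexistence at $\lambda=n^2/4$. Then $q(x)\equiv 0$.
   Context: For $\lambda\in\mathbb{C}$ consider the equation $-y''+q(x)y=\lambda y$, $x\in\mathbb{R}$. Let $u(x;\lambda)$ and $v(x;\lambda)$ be its solutions with $u(0;\lambda)=1$, $u'(0;\lambda)=0$ and $v(0;\lambda)=0$, $v'(0;\lambda)=1$ (primes denote derivatives with respect to $x$). The Hill discriminant is the entire function $\Delta(\lambda)=u(2\pi;\lambda)+v'(2\pi;\lambda)$. The spectrum of $H$ in $L^2(\mathbb{R})$ is characterized by $\sigma(H)=\{\lambda\in\mathbb{C}:\Delta(\lambda)\in[-2,2]\}$. A Floquet solution is a nonzero solution $\phi$ with $\phi(x+2\pi)=\rho\,\phi(x)$ for all $x$, for some constant $\rho\in\mathbb{C}$ (a Floquet multiplier); the multipliers are the roots of $\rho^2-\Delta(\lambda)\rho+1=0$. For a $\lambda$ with $\Delta(\lambda)=\pm 2$ (so that the only multiplier is $\rho=\pm1$, with the same sign), one says that there is coexistence at $\lambda$ if there exist two linearly independent Floquet solutions for this $\lambda$; equivalently, all solutions of $-y''+qy=\lambda y$ are $2\pi$-periodic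 (when $\Delta(\lambda)=2$), respectively all satisfy $y(x+2\pi)=-y(x)$ (when $\Delta(\lambda)=-2$). *)

theory Defs
  imports "HOL-Analysis.Analysis"
begin

section \<open>The Hill equation and its discriminant\<close>

definition hill_solution :: "(real \<Rightarrow> complex) \<Rightarrow> complex \<Rightarrow> (real \<Rightarrow> complex) \<Rightarrow> bool" where
  "hill_solution q l y \<longleftrightarrow>
     (\<exists>y' y''. (\<forall>x. (y has_vector_derivative y' x) (at x)) \<and>
               (\<forall>x. (y' has_vector_derivative y'' x) (at x)) \<and>
               (\<forall>x. - y'' x + q x * y x = l * y x))"

text \<open>For continuous q the initial value problem has exactly one solution on the whole line, so
  the definite description below denotes it.\<close>

definition hill_ivp :: "(real \<Rightarrow> complex) \<Rightarrow> complex \<Rightarrow> complex \<Rightarrow> complex \<Rightarrow> real \<Rightarrow> complex" where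
  "hill_ivp q l a b =
     (THE y. hill_solution q l y \<and> y 0 = a \<and> vector_derivative y (at 0) = b)"

definition hill_u :: "(real \<Rightarrow> complex) \<Rightarrow> complex \<Rightarrow> real \<Rightarrow> complex" where
  "hill_u q l = hill_ivp q l 1 0"

definition hill_v :: "(real \<Rightarrow> complex) \<Rightarrow> complex \<Rightarrow> real \<Rightarrow> complex" where
  "hill_v q l = hill_ivp q l 0 1"

definition hill_discriminant :: "(real \<Rightarrow> complex) \<Rightarrow> complex \<Rightarrow> complex" where
  "hill_discriminant q l = hill_u q l (2 * pi) + vector_derivative (hill_v q l) (at (2 * pi))"

definition floquet_solution :: "(real \<Rightarrow> complex) \<Rightarrow> complex \<Rightarrow> (real \<Rightarrow> complex) \<Rightarrow> bool" where
  "floquet_solution q l \<phi> \<longleftrightarrow>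
     hill_solution q l \<phi> \<and> (\<exists>x. \<phi> x \<noteq> 0) \<and> (\<exists>\<rho>. \<forall>x. \<phi> (x + 2 * pi) = \<rho> * \<phi> x)"

definition lin_indep2 :: "(real \<Rightarrow> complex) \<Rightarrow> (real \<Rightarrow> complex) \<Rightarrow> bool" where
  "lin_indep2 \<phi> \<psi> \<longleftrightarrow> (\<forall>a b. (\<forall>x. a * \<phi> x + b * \<psi> x = 0) \<longrightarrow> a = 0 \<and> b = 0)"

text \<open>Coexistence is only spoken of where the discriminant is 2 or -2; elsewhere two independent
  Floquet solutions always exist, with two different multipliers.\<close>

definition coexistence :: "(real \<Rightarrow> complex) \<Rightarrow> complex \<Rightarrow> bool" where
  "coexistence q l \<longleftrightarrow>
     hill_discriminant q l \<in> {2, - 2} \<and>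
     (\<exists>\<phi> \<psi>. floquet_solution q l \<phi> \<and> floquet_solution q l \<psi> \<and> lin_indep2 \<phi> \<psi>)"


section \<open>The Hill operator in $L^2(\mathbb{R})$ and its spectrum\<close>

text \<open>Elements of $L^2(\mathbb{R})$ are represented by square-integrable functions; two of them
  represent the same element iff they agree almost everywhere.\<close>

definition L2 :: "(real \<Rightarrow> complex) set" where
  "L2 = {f \<in> borel_measurable lborel. integrable lborel (\<lambda>x. (cmod (f x))\<^sup>2)}"

definition L2_nrm :: "(real \<Rightarrow> complex) \<Rightarrow> real" where
  "L2_nrm f = sqrt (integral\<^sup>L lborel (\<lambda>x. (cmod (f x))\<^sup>2))"

text \<open>The graph of a linear operator in $L^2(\mathbb{R})$ is given as a set of pairs of
  representatives. A number l is in the resolvent set iff T - l maps the domain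
  bijectively onto $L^2(\mathbb{R})$ with bounded inverse.\<close>

definition resolvent_set ::
    "((real \<Rightarrow> complex) \<times> (real \<Rightarrow> complex)) set \<Rightarrow> complex set" where
  "resolvent_set T = {l.
     (\<forall>f h. (f, h) \<in> T \<longrightarrow> (AE x in lborel. h x - l * f x = 0) \<longrightarrow> (AE x in lborel. f x = 0)) \<and>
     (\<forall>g \<in> L2. \<exists>f h. (f, h) \<in> T \<and> (AE x in lborel. h x - l * f x = g x)) \<and>
     (\<exists>C. \<forall>f h. (f, h) \<in> T \<longrightarrow> L2_nrm f \<le> C * L2_nrm (\<lambda>x. h x - l * f x))}"

definition op_spectrum ::
    "((real \<Rightarrow> complex) \<times> (real \<Rightarrow> complex)) set \<Rightarrow> complex set" where
  "op_spectrum T = - resolvent_set T"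

text \<open>The domain of H is the Sobolev space $H^2(\mathbb{R})$: those f in $L^2$ that have (in the
  unique continuous representative, the only one admitted here) a locally absolutely continuous
  derivative whose almost-everywhere derivative g is in $L^2$. Absolute continuity is expressed
  by the fundamental theorem of calculus for f'. Since g is locally Lebesgue integrable, the gauge
  integral below is its Lebesgue integral.\<close>

definition hill_operator ::
    "(real \<Rightarrow> complex) \<Rightarrow> ((real \<Rightarrow> complex) \<times> (real \<Rightarrow> complex)) set" where
  "hill_operator q = {(f, h). f \<in> L2 \<and> h \<in> L2 \<and>
     (\<exists>f' g. g \<in> L2 \<and>
        (\<forall>x. (f has_vector_derivative f' x) (at x)) \<and>
        (\<forall>a b. a \<le> b \<longrightarrow> (g has_integral (f' b - f' a)) {a..b}) \<and>
        (AE x in lborel. h x = - g x + q x * f x))}"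

end

theory Submission
  imports Defs "HOL-Complex_Analysis.Conformal_Mappings"
begin

text \<open>Let \<open>v\<close> be the solution with \<open>v 0 = 0\<close> and \<open>v' 0 = 1\<close>. The zeros in \<open>l\<close> of its value at \<open>2 * pi\<close> are the
  Dirichlet eigenvalues on a period. Coexistence makes translation by a period act as a
  scalar on all solutions (\<open>coexistence_multiplier\<close>), so that every number \<open>n\<^sup>2 / 4\<close> with
  \<open>n \<ge> 1\<close> is a Dirichlet eigenvalue, not only of \<open>q\<close> but also of each of its translates
  (\<open>coexistence_hill_v_shift\<close>).

  These eigenvalues determine \<open>v\<close> at \<open>2 * pi\<close>. In the variable \<open>k\<close> with \<open>l = k\<^sup>2\<close>, the entire function
  \<open>k * v (2 * pi)\<close> vanishes at the zeros of \<open>sin (2 * pi * k)\<close>, and it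
  differs from this sine by a term that is smaller by a factor of order \<open>1 / \<bar>k\<bar>\<close>
  (\<open>sol_growth\<close>). The quotient of the two is therefore entire and tends to 1 along large squares, so it equals 1
  (\<open>hill_v_eq_sine\<close>).

  Consequently the Dirichlet solution of the translate of \<open>q\<close> by \<open>t\<close>, evaluated after one period,
  is the same for all \<open>t\<close>. As a function of \<open>t\<close> it is built bilinearly from solutions of the equation, and its
  constancy at a single nonzero value already forces \<open>q\<close> to be constant (\<open>constant_potential\<close>). For a constant
  potential \<open>c\<close>, comparing the zeros of the known function \<open>v\<close> with those of the sine shows that
  \<open>4 * c + n\<^sup>2\<close> is a perfect square for every \<open>n \<ge> 1\<close>, and then \<open>c = 0\<close>, since squares are sparse.\<close>

section \<open>Existence for linear initial value problems\<close>

lemma antiderivative_on_line: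
  fixes f :: "real \<Rightarrow> 'a::euclidean_space"
  assumes "continuous_on UNIV f"
  shows "\<exists>F. F 0 = 0 \<and> (\<forall>x. (F has_vector_derivative f x) (at x))"
proof -
  have "\<exists>F. \<forall>x::real. (-\<infinity>::ereal) < x \<longrightarrow> x < (\<infinity>::ereal) \<longrightarrow> (F has_vector_derivative f x) (at x)"
    using assms by (intro einterval_antiderivative) (auto simp: continuous_on_eq_continuous_at)
  then obtain F where F: "\<And>x. (F has_vector_derivative f x) (at x)" by auto
  have "((\<lambda>x. F x - F 0) has_vector_derivative f x) (at x)" for x
    using has_vector_derivative_diff[OF F[of x] has_vector_derivative_const[of "F 0" "at x"]] by simp
  then show ?thesis by (intro exI[of _ "\<lambda>x. F x - F 0"]) auto
qed

text \<open>This is the induction step behind the factorial decay of the Picard iterates, in a form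
  that covers both directions from the initial point.\<close>

lemma antiderivative_monomial_bound:
  fixes F :: "real \<Rightarrow> 'a::real_normed_vector"
  assumes F0: "F 0 = 0" and F: "\<And>x. (F has_vector_derivative f x) (at x)"
    and bound: "\<And>s. \<bar>s\<bar> < R \<Longrightarrow> norm (f s) \<le> K * \<bar>s\<bar> ^ n" and x: "\<bar>x\<bar> < R"
  shows "norm (F x) \<le> K * \<bar>x\<bar> ^ Suc n / Suc n"
proof -
  have half_line: "norm (G t) \<le> K * t ^ Suc n / Suc n"
    if "0 < t" "t < R" "G 0 = 0" and G: "\<And>x. (G has_vector_derivative g x) (at x)"
      and g: "\<And>s. 0 < s \<Longrightarrow> s < R \<Longrightarrow> norm (g s) \<le> K * s ^ n"
    for G g :: "real \<Rightarrow> 'a" and t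
  proof -
    have "norm (G t - G 0) \<le> K * t ^ Suc n / Suc n - K * 0 ^ Suc n / Suc n"
    proof (rule differentiable_bound_general[where f' = g and \<phi>' = "\<lambda>s. K * s ^ n"])
      show "continuous_on {0..t} G"
        using G by (meson continuous_on_vector_derivative has_vector_derivative_at_within)
      show "((\<lambda>s. K * s ^ Suc n / Suc n) has_vector_derivative K * x ^ n) (at x)" for x
        unfolding has_real_derivative_iff_has_vector_derivative[symmetric]
        by (rule derivative_eq_intros refl | simp)+
    qed (use that in \<open>auto intro!: continuous_intros\<close>)
    then show ?thesis using that by simp
  qed
  show ?thesis
  proof (cases "x = 0")
    case False
    show ?thesis
    proof (cases "x > 0")
      case True
      have "norm (F x) \<le> K * x ^ Suc n / Suc n"
      proof (rule half_line[OF _ _ F0 F])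
        show "norm (f s) \<le> K * s ^ n" if "0 < s" "s < R" for s
          using bound[of s] that by simp
      qed (use True x in auto)
      then show ?thesis using True by simp
    next
      case False
      have "((\<lambda>t. F (- t)) has_vector_derivative - f (- t)) (at t)" for t
        using vector_diff_chain_at[OF has_vector_derivative_minus[OF has_vector_derivative_id] F[of "-t"]]
        by (simp add: o_def)
      then have "norm (F (- (- x))) \<le> K * (- x) ^ Suc n / Suc n"
      proof (rule half_line[of "- x" "\<lambda>t. F (- t)" "\<lambda>t. - f (- t)", rotated 3])
        show "norm (- f (- s)) \<le> K * s ^ n" if "0 < s" "s < R" for s
          using bound[of "- s"] that by simp
      qed (use False \<open>x \<noteq> 0\<close> x F0 in auto)
      then show ?thesis using False by simp
    qed
  qed (simp add: F0)
qed

text \<open>The Picard iterates are arranged as a series whose \<open>n\<close>-th term is an antiderivative of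
  \<open>A\<close> applied to the previous one. On \<open>\<bar>x\<bar> < R\<close>, where \<open>A\<close> is bounded by \<open>M\<close>, that term is at most
  \<open>norm w0 * (M * R) ^ n / fact n\<close>, so the series and its termwise derivative converge uniformly.
  The sum does not depend on \<open>R\<close>, and it therefore solves the equation on the whole line.\<close>

lemma linear_ivp_exists:
  fixes A :: "real \<Rightarrow> 'a::euclidean_space \<Rightarrow> 'a"
  assumes lin: "\<And>x. bounded_linear (A x)"
    and cont: "\<And>f. continuous_on UNIV f \<Longrightarrow> continuous_on UNIV (\<lambda>x. A x (f x))"
    and loc_bound: "\<And>R. \<exists>M\<ge>0. \<forall>x w. \<bar>x\<bar> \<le> R \<longrightarrow> norm (A x w) \<le> M * norm w"
  shows "\<exists>W. W 0 = w0 \<and> (\<forall>x. (W has_vector_derivative A x (W x)) (at x))"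
proof -
  define P where "P = (\<lambda>f::real \<Rightarrow> 'a. SOME F. F 0 = 0 \<and> (\<forall>x. (F has_vector_derivative f x) (at x)))"
  have P: "P f 0 = 0 \<and> (\<forall>x. (P f has_vector_derivative f x) (at x))" if "continuous_on UNIV f" for f
    unfolding P_def by (rule someI_ex[OF antiderivative_on_line[OF that]])
  define V where "V = rec_nat (\<lambda>_::real. w0) (\<lambda>_ f. P (\<lambda>x. A x (f x)))"
  have V0: "V 0 = (\<lambda>_. w0)" and VS: "V (Suc n) = P (\<lambda>x. A x (V n x))" for n
    by (simp_all add: V_def)
  have Vc: "continuous_on UNIV (V n)" for n
  proof (induction n)
    case (Suc n)
    have "(P (\<lambda>x. A x (V n x)) has_vector_derivative A x (V n x)) (at x)" for x
      using P[OF cont[OF Suc]] by blast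
    then show ?case unfolding VS
      by (intro continuous_on_vector_derivative) (rule has_vector_derivative_at_within)
  qed (simp add: V0)
  have V'0: "V (Suc n) 0 = 0"
    and V': "(V (Suc n) has_vector_derivative A x (V n x)) (at x)" for n x
    using P[OF cont[OF Vc[of n]]] by (simp_all only: VS)
  define V' where "V' = (\<lambda>n x. case n of 0 \<Rightarrow> 0 | Suc m \<Rightarrow> A x (V m x))"
  have der: "(V n has_vector_derivative V' n x) (at x)" for n x
    using V' by (cases n) (auto simp: V'_def V0)
  define W where "W = (\<lambda>x. \<Sum>n. V n x)"
  have main: "summable (\<lambda>n. V n x) \<and> (W has_vector_derivative A x (W x)) (at x)" for x
  proof -
    define R where "R = \<bar>x\<bar> + 1"
    have R: "R > 0" "\<bar>x\<bar> < R" by (auto simp: R_def)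
    obtain M where M: "M \<ge> 0" "\<And>x w. \<bar>x\<bar> \<le> R \<Longrightarrow> norm (A x w) \<le> M * norm w"
      using loc_bound[of R] by blast
    have bd: "norm (V n t) \<le> norm w0 * M ^ n / fact n * \<bar>t\<bar> ^ n" if "\<bar>t\<bar> < R" for n t
      using that
    proof (induction n arbitrary: t)
      case (Suc n)
      have "norm (A s (V n s)) \<le> (M * (norm w0 * M ^ n / fact n)) * \<bar>s\<bar> ^ n" if "\<bar>s\<bar> < R" for s
      proof -
        have "norm (A s (V n s)) \<le> M * norm (V n s)" using M(2)[of s] that by simp
        also have "\<dots> \<le> M * (norm w0 * M ^ n / fact n * \<bar>s\<bar> ^ n)"
          by (intro mult_left_mono Suc.IH M that)
        finally show ?thesis by (simp add: algebra_simps)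
      qed
      from antiderivative_monomial_bound[OF V'0 V' this Suc.prems]
      show ?case by (simp add: field_simps)
    qed (simp add: V0)
    define S where "S = {-R<..<R}"
    define B where "B = (\<lambda>n. norm w0 * ((M * R) ^ n / fact n))"
    have B: "norm (V n t) \<le> B n" if "t \<in> S" for n t
    proof -
      have "norm (V n t) \<le> norm w0 * M ^ n / fact n * \<bar>t\<bar> ^ n"
        using bd[of t n] that by (auto simp: S_def)
      also have "\<dots> \<le> norm w0 * M ^ n / fact n * R ^ n"
        using that M by (intro mult_left_mono power_mono) (auto simp: S_def)
      finally show ?thesis by (simp add: B_def power_mult_distrib)
    qed
    have sB: "summable B" unfolding B_def
      by (intro summable_mult) (use summable_exp[of "M * R"] in \<open>simp add: field_simps\<close>)
    have sV: "summable (\<lambda>n. V n t)" if "t \<in> S" for t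
      by (rule summable_comparison_test'[OF sB B]) (rule that)
    define B' where "B' = (\<lambda>n. case n of 0 \<Rightarrow> 0 | Suc m \<Rightarrow> M * B m)"
    have sB': "summable B'"
      by (subst summable_Suc_iff[symmetric]) (auto simp: B'_def intro: summable_mult sB)
    have B': "norm (V' n t) \<le> B' n" if "t \<in> S" for n t
    proof (cases n)
      case (Suc m)
      have "norm (A t (V m t)) \<le> M * norm (V m t)" using M(2)[of t] that by (auto simp: S_def)
      also have "\<dots> \<le> M * B m" by (intro mult_left_mono B that M)
      finally show ?thesis by (simp add: V'_def B'_def Suc)
    qed (auto simp: V'_def B'_def)
    have AW: "(\<Sum>n. V' n t) = A t (W t)" if "t \<in> S" for t
    proof -
      have "summable (\<lambda>n. V' n t)"
        by (rule summable_comparison_test'[OF sB' B']) (rule that)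
      then have "(\<Sum>n. V' n t) = (\<Sum>n. V' (Suc n) t)"
        by (subst suminf_split_head) (simp_all add: V'_def)
      also have "\<dots> = (\<Sum>n. A t (V n t))" by (simp add: V'_def)
      also have "\<dots> = A t (W t)" unfolding W_def
        by (rule bounded_linear.suminf[OF lin sV[OF that], symmetric])
      finally show ?thesis .
    qed
    have unif: "uniform_limit S (\<lambda>n t. \<Sum>i<n. V' i t) (\<lambda>t. \<Sum>i. V' i t) sequentially"
      by (rule Weierstrass_m_test[OF B' sB'])
    have "\<exists>g. \<forall>t\<in>S. (\<lambda>n. V n t) sums (g t)
        \<and> (g has_derivative (\<lambda>h. h *\<^sub>R (\<Sum>i. V' i t))) (at t within S)"
    proof (rule has_derivative_series[where f' = "\<lambda>n t h. h *\<^sub>R V' n t" and x = x and l = "W x"])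
      show "convex S" by (simp add: S_def)
      show "(V n has_derivative (\<lambda>h. h *\<^sub>R V' n t)) (at t within S)" for n t
        using der[of n t] by (auto simp: has_vector_derivative_def intro: has_derivative_at_withinI)
      show "x \<in> S" using R by (auto simp: S_def)
      then show "(\<lambda>n. V n x) sums W x" unfolding W_def using sV by (simp add: summable_sums)
      fix e :: real assume "e > 0"
      from uniform_limitD[OF unif this]
      show "\<forall>\<^sub>F n in sequentially. \<forall>t\<in>S. \<forall>h.
          norm ((\<Sum>i<n. h *\<^sub>R V' i t) - h *\<^sub>R (\<Sum>i. V' i t)) \<le> e * norm h"
      proof (eventually_elim, intro ballI allI)
        fix n t h assume "\<forall>x\<in>S. dist (\<Sum>i<n. V' i x) (\<Sum>i. V' i x) < e" "t \<in> S"
        then have "norm ((\<Sum>i<n. V' i t) - (\<Sum>i. V' i t)) \<le> e" by (auto simp: dist_norm intro: less_imp_le)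
        then have "\<bar>h\<bar> * norm ((\<Sum>i<n. V' i t) - (\<Sum>i. V' i t)) \<le> \<bar>h\<bar> * e"
          by (intro mult_left_mono) auto
        then show "norm ((\<Sum>i<n. h *\<^sub>R V' i t) - h *\<^sub>R (\<Sum>i. V' i t)) \<le> e * norm h"
          by (simp add: scaleR_sum_right[symmetric] scaleR_diff_right[symmetric] mult.commute)
      qed
    qed
    then obtain g where g: "\<And>t. t \<in> S \<Longrightarrow> (\<lambda>n. V n t) sums (g t)"
        "\<And>t. t \<in> S \<Longrightarrow> (g has_derivative (\<lambda>h. h *\<^sub>R (\<Sum>i. V' i t))) (at t within S)" by blast
    have gW: "g t = W t" if "t \<in> S" for t unfolding W_def using g(1)[OF that] by (simp add: sums_iff)
    have xS: "x \<in> S" "open S" using R by (auto simp: S_def)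
    have "(g has_vector_derivative A x (W x)) (at x)"
      using g(2)[OF xS(1)] AW[OF xS(1)] at_within_open[OF xS] by (simp add: has_vector_derivative_def)
    then have "(W has_vector_derivative A x (W x)) (at x)"
      by (rule has_vector_derivative_transform_within_open[OF _ xS(2,1) gW])
    with sV[OF xS(1)] show ?thesis by blast
  qed
  have "V n 0 = (if n = 0 then w0 else 0)" for n
    by (cases n) (auto simp: V0 V'0)
  moreover from this have "(\<Sum>n. V n 0) = (\<Sum>n\<in>{0}. V n 0)"
    by (intro suminf_finite) auto
  ultimately have "W 0 = w0" by (simp add: W_def)
  with main show ?thesis by blast
qed

section \<open>Solutions of the Hill equation\<close>

text \<open>The equation \<open>y'' = p * y\<close> as a first-order system. Carrying the derivative along as a second
  function makes the initial data and the Wronskians plain terms.\<close>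

definition solves :: "(real \<Rightarrow> complex) \<Rightarrow> (real \<Rightarrow> complex) \<Rightarrow> (real \<Rightarrow> complex) \<Rightarrow> bool" where
  "solves p y y' \<longleftrightarrow> (\<forall>x. (y has_vector_derivative y' x) (at x)) \<and>
                (\<forall>x. (y' has_vector_derivative p x * y x) (at x))"

lemma sol_continuous:
  assumes "solves p y y'"
  shows "continuous_on S y" "continuous_on S y'"
proof -
  have "(y has_vector_derivative y' x) (at x within S)"
       "(y' has_vector_derivative p x * y x) (at x within S)" for x
    using assms by (auto simp: solves_def intro: has_vector_derivative_at_within)
  then show "continuous_on S y" "continuous_on S y'"
    by (intro continuous_on_vector_derivative; blast)+
qed

lemma sol_exists:
  assumes "continuous_on UNIV p"
  shows "\<exists>y y'. solves p y y' \<and> y 0 = a \<and> y' 0 = b"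
proof -
  define A :: "real \<Rightarrow> complex \<times> complex \<Rightarrow> complex \<times> complex"
    where "A = (\<lambda>x w. (snd w, p x * fst w))"
  have lin: "bounded_linear (A x)" for x
    unfolding A_def
    by (intro bounded_linear_Pair bounded_linear_snd bounded_linear_const_mult bounded_linear_fst)
  have bound: "\<exists>M\<ge>0. \<forall>x w. \<bar>x\<bar> \<le> R \<longrightarrow> norm (A x w) \<le> M * norm w" for R
  proof -
    have "compact (p ` {-R..R})"
      by (intro compact_continuous_image continuous_on_subset[OF assms]) auto
    then obtain M where M: "\<And>x. \<bar>x\<bar> \<le> R \<Longrightarrow> norm (p x) \<le> M"
      by (fastforce dest: compact_imp_bounded simp: bounded_iff abs_le_iff)
    have "norm (A x w) \<le> (1 + \<bar>M\<bar>) * norm w" if "\<bar>x\<bar> \<le> R" for x w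
    proof -
      have "norm (A x w) \<le> norm (snd w) + norm (p x) * norm (fst w)"
        unfolding A_def by (metis norm_Pair_le norm_mult)
      also have "\<dots> \<le> 1 * norm w + \<bar>M\<bar> * norm w"
        using M[OF that] by (intro add_mono mult_mono) (auto intro: norm_snd_le[of "snd w" "fst w", simplified] norm_fst_le[of "fst w" "snd w", simplified])
      finally show ?thesis by (simp add: algebra_simps)
    qed
    then show ?thesis by (intro exI[of _ "1 + \<bar>M\<bar>"]) auto
  qed
  obtain W where W0: "W 0 = (a, b)" and W: "\<And>x. (W has_vector_derivative A x (W x)) (at x)"
    using linear_ivp_exists[of A "(a, b)", OF lin _ bound] assms
    by (fastforce simp: A_def intro: continuous_intros)
  have "((\<lambda>x. fst (W x)) has_vector_derivative snd (W x)) (at x)"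
       "((\<lambda>x. snd (W x)) has_vector_derivative p x * fst (W x)) (at x)" for x
    using bounded_linear.has_vector_derivative[OF bounded_linear_fst W[of x]]
      bounded_linear.has_vector_derivative[OF bounded_linear_snd W[of x]]
    by (simp_all add: A_def)
  then have "solves p (\<lambda>x. fst (W x)) (\<lambda>x. snd (W x))" by (simp add: solves_def)
  with W0 show ?thesis by force
qed

lemma sol_shift:
  assumes "solves p y y'"
  shows "solves (\<lambda>x. p (x + t)) (\<lambda>x. y (x + t)) (\<lambda>x. y' (x + t))"
proof -
  have "((\<lambda>x. x + t) has_vector_derivative 1) (at x)" for x
    by (auto intro!: derivative_eq_intros)
  then show ?thesis
    using assms vector_diff_chain_at[of "\<lambda>x. x + t" 1] unfolding solves_def o_def by fastforce
qed

text \<open>Green's formula; with equal coefficients it says that the Wronskian is constant.\<close>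

lemma green_has_vector_derivative:
  assumes "solves p y y'" "solves r w w'"
  shows "((\<lambda>s. y' s * w s - y s * w' s) has_vector_derivative (p x - r x) * y x * w x) (at x)"
proof -
  have "(y has_vector_derivative y' x) (at x)" "(y' has_vector_derivative p x * y x) (at x)"
    "(w has_vector_derivative w' x) (at x)" "(w' has_vector_derivative r x * w x) (at x)"
    using assms by (auto simp: solves_def)
  then show ?thesis
    by (auto intro!: derivative_eq_intros simp: algebra_simps)
qed

lemma green_integral:
  assumes "solves p y y'" "solves r w w'" "a \<le> b"
  shows "((\<lambda>s. (p s - r s) * y s * w s) has_integral
            (y' b * w b - y b * w' b) - (y' a * w a - y a * w' a)) {a..b}"
  by (rule fundamental_theorem_of_calculus[OF assms(3)])
     (rule has_vector_derivative_at_within[OF green_has_vector_derivative[OF assms(1,2)]])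

lemma zero_derivative_const:
  fixes f :: "real \<Rightarrow> complex"
  assumes "\<And>x. (f has_vector_derivative 0) (at x)"
  shows "f x = f y"
proof -
  have "\<exists>c. \<forall>x\<in>UNIV. f x = c"
    by (rule has_derivative_zero_constant) (use assms in \<open>auto simp: has_vector_derivative_def\<close>)
  then show ?thesis by auto
qed

lemma wronskian_const:
  assumes "solves p y y'" "solves p w w'"
  shows "y' x * w x - y x * w' x = y' t * w t - y t * w' t"
proof (rule zero_derivative_const[of "\<lambda>s. y' s * w s - y s * w' s"])
  show "((\<lambda>s. y' s * w s - y s * w' s) has_vector_derivative 0) (at x)" for x
    using green_has_vector_derivative[OF assms, of x] by simp
qed

text \<open>The normalised solutions; for \<open>p x = q x - l\<close> these are the \<open>u\<close> and \<open>v\<close> of the discriminant.\<close>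

definition fundamental where
  "fundamental p u u' v v' \<longleftrightarrow>
     solves p u u' \<and> solves p v v' \<and> u 0 = 1 \<and> u' 0 = 0 \<and> v 0 = 0 \<and> v' 0 = (1 :: complex)"

lemma fundamental_exists:
  assumes "continuous_on UNIV p"
  shows "\<exists>u u' v v'. fundamental p u u' v v'"
  using sol_exists[OF assms, of 1 0] sol_exists[OF assms, of 0 1] unfolding fundamental_def by blast

lemma fundamental_wronskian:
  assumes "fundamental p u u' v v'"
  shows "u x * v' x - u' x * v x = 1"
  using wronskian_const[of p u u' v v' x 0] assms by (auto simp: fundamental_def algebra_simps)

text \<open>Cramer's rule: the coefficients of \<open>y\<close> in the basis \<open>u\<close>, \<open>v\<close> are Wronskians, hence constant,
  and the Wronskian of the basis is 1. Uniqueness for the initial value problem follows from this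
  and the existence of a basis.\<close>

lemma sol_eq_fundamental:
  assumes F: "fundamental p u u' v v'" and y: "solves p y y'"
  shows "y x = y 0 * u x + y' 0 * v x" "y' x = y 0 * u' x + y' 0 * v' x"
proof -
  have 1: "y' x * u x - y x * u' x = y' 0" and 2: "y' x * v x - y x * v' x = - y 0"
    using wronskian_const[OF y, of u u' x 0] wronskian_const[OF y, of v v' x 0] F
    by (auto simp: fundamental_def)
  have 3: "u x * v' x - u' x * v x = 1" by (rule fundamental_wronskian[OF F])
  have "y x * (u x * v' x - u' x * v x)
      = - (y' x * v x - y x * v' x) * u x + (y' x * u x - y x * u' x) * v x"
    by (simp add: algebra_simps)
  then show "y x = y 0 * u x + y' 0 * v x" by (simp add: 1 2 3)
  have "y' x * (u x * v' x - u' x * v x)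
      = - (y' x * v x - y x * v' x) * u' x + (y' x * u x - y x * u' x) * v' x"
    by (simp add: algebra_simps)
  then show "y' x = y 0 * u' x + y' 0 * v' x" by (simp add: 1 2 3)
qed

lemma sol_unique:
  assumes "continuous_on UNIV p" "solves p y y'" "solves p w w'" "y 0 = w 0" "y' 0 = w' 0"
  shows "y = w" "y' = w'"
proof -
  obtain u u' v v' where F: "fundamental p u u' v v'"
    using fundamental_exists[OF assms(1)] by blast
  have "y x = w x \<and> y' x = w' x" for x
    using sol_eq_fundamental[OF F assms(2), of x] sol_eq_fundamental[OF F assms(3), of x] assms(4,5)
    by simp
  then show "y = w" "y' = w'" by auto
qed

lemma hill_solution_iff: "hill_solution q l y \<longleftrightarrow> (\<exists>y'. solves (\<lambda>x. q x - l) y y')"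
proof
  assume "hill_solution q l y"
  then obtain y' y'' where y: "\<And>x. (y has_vector_derivative y' x) (at x)"
      "\<And>x. (y' has_vector_derivative y'' x) (at x)" "\<And>x. - y'' x + q x * y x = l * y x"
    by (auto simp: hill_solution_def)
  have "y'' x = (q x - l) * y x" for x using y(3)[of x] by (simp add: algebra_simps)
  with y(1,2) show "\<exists>y'. solves (\<lambda>x. q x - l) y y'"
    unfolding solves_def by (intro exI[of _ y']) auto
next
  assume "\<exists>y'. solves (\<lambda>x. q x - l) y y'"
  then obtain y' where "solves (\<lambda>x. q x - l) y y'" ..
  then show "hill_solution q l y"
    unfolding hill_solution_def solves_def
    by (intro exI[of _ y'] exI[of _ "\<lambda>x. (q x - l) * y x"]) (auto simp: algebra_simps)
qed

lemma hill_ivp_eq: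
  assumes q: "continuous_on UNIV q" and y: "solves (\<lambda>x. q x - l) y y'"
  shows "hill_ivp q l (y 0) (y' 0) = y"
  unfolding hill_ivp_def
proof (rule the_equality)
  have "(y has_vector_derivative y' 0) (at 0)" using y by (simp add: solves_def)
  then show "hill_solution q l y \<and> y 0 = y 0 \<and> vector_derivative y (at 0) = y' 0"
    using y by (auto simp: hill_solution_iff vector_derivative_at)
next
  fix w assume w: "hill_solution q l w \<and> w 0 = y 0 \<and> vector_derivative w (at 0) = y' 0"
  then obtain w' where w': "solves (\<lambda>x. q x - l) w w'" by (auto simp: hill_solution_iff)
  then have "(w has_vector_derivative w' 0) (at 0)" by (simp add: solves_def)
  with w have "w' 0 = y' 0" by (simp add: vector_derivative_at)
  moreover have "w 0 = y 0" using w by blast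
  moreover have "continuous_on UNIV (\<lambda>x. q x - l)" by (intro continuous_intros q)
  ultimately have "w = y" by (metis sol_unique(1)[OF _ w' y])
  then show "w = y" .
qed

lemma hill_discriminant_eq:
  assumes "continuous_on UNIV q" "fundamental (\<lambda>x. q x - l) u u' v v'"
  shows "hill_discriminant q l = u (2 * pi) + v' (2 * pi)"
proof -
  have "hill_u q l = u" "hill_v q l = v"
    using hill_ivp_eq[OF assms(1), of l u u'] hill_ivp_eq[OF assms(1), of l v v'] assms(2)
    by (auto simp: fundamental_def hill_u_def hill_v_def)
  moreover have "(v has_vector_derivative v' (2 * pi)) (at (2 * pi))"
    using assms(2) by (simp add: fundamental_def solves_def)
  ultimately show ?thesis by (simp add: hill_discriminant_def vector_derivative_at)
qed

section \<open>Coexistence\<close>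

text \<open>Two independent Floquet solutions have multipliers with product 1, because the translation by a
  period preserves their nonzero Wronskian, and with sum the discriminant, because that is the trace
  of the translation. A discriminant of 2 or -2 forces the multipliers to be equal, and
  then the translation acts as a scalar on all solutions.\<close>

lemma coexistence_multiplier:
  assumes q: "continuous_on UNIV q" and co: "coexistence q l"
  shows "\<exists>\<rho>. \<forall>y y'. solves (\<lambda>x. q x - l) y y' \<longrightarrow> (\<forall>x. y (x + 2 * pi) = \<rho> * y x)"
proof -
  let ?p = "\<lambda>x. q x - l"
  have p: "continuous_on UNIV ?p" by (intro continuous_intros q)
  obtain f f' g g' \<rho> \<sigma> where disc: "hill_discriminant q l \<in> {2, -2}"
      and f: "solves ?p f f'" "\<And>x. f (x + 2 * pi) = \<rho> * f x"
      and g: "solves ?p g g'" "\<And>x. g (x + 2 * pi) = \<sigma> * g x" and ind: "lin_indep2 f g"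
    using co unfolding coexistence_def floquet_solution_def hill_solution_iff by blast
  obtain u u' v v' where F: "fundamental ?p u u' v v'"
    using fundamental_exists[OF p] by blast
  have derivative_multiplier: "h' (x + 2 * pi) = c * h' x"
    if "solves ?p h h'" "\<And>x. h (x + 2 * pi) = c * h x" for h h' c x
  proof (rule vector_derivative_unique_at)
    show "((\<lambda>x. h (x + 2 * pi)) has_vector_derivative c * h' x) (at x)"
      unfolding that(2) using that(1) by (auto simp: solves_def intro: has_vector_derivative_mult_right)
    show "((\<lambda>x. h (x + 2 * pi)) has_vector_derivative h' (x + 2 * pi)) (at x)"
      using sol_shift[OF that(1), of "2 * pi"] by (simp add: solves_def)
  qed
  define w where "w = f 0 * g' 0 - f' 0 * g 0"
  have w: "w \<noteq> 0"
  proof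
    assume "w = 0"
    have comb: "a * f x + b * g x = 0" if "a * f 0 + b * g 0 = 0" "a * f' 0 + b * g' 0 = 0" for a b x
    proof -
      have "a * f x + b * g x = (a * f 0 + b * g 0) * u x + (a * f' 0 + b * g' 0) * v x"
        using sol_eq_fundamental(1)[OF F f(1), of x] sol_eq_fundamental(1)[OF F g(1), of x] by algebra
      then show ?thesis using that by simp
    qed
    have vanish: "a = 0 \<and> b = 0" if "a * f 0 + b * g 0 = 0" "a * f' 0 + b * g' 0 = 0" for a b
      using ind comb[OF that] unfolding lin_indep2_def by blast
    have "g 0 = 0 \<and> - f 0 = 0"
    proof (rule vanish)
      show "g 0 * f 0 + - f 0 * g 0 = 0" by simp
      show "g 0 * f' 0 + - f 0 * g' 0 = 0" using \<open>w = 0\<close> unfolding w_def by algebra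
    qed
    moreover have "g' 0 = 0 \<and> - f' 0 = 0"
    proof (rule vanish)
      show "g' 0 * f 0 + - f' 0 * g 0 = 0" using \<open>w = 0\<close> unfolding w_def by algebra
      show "g' 0 * f' 0 + - f' 0 * g' 0 = 0" by simp
    qed
    ultimately show False using vanish[of 1 1] by simp
  qed
  have per: "f (2 * pi) = \<rho> * f 0" "f' (2 * pi) = \<rho> * f' 0" "g (2 * pi) = \<sigma> * g 0" "g' (2 * pi) = \<sigma> * g' 0"
    using f(2)[of 0] g(2)[of 0] derivative_multiplier[OF f, of 0] derivative_multiplier[OF g, of 0] by auto
  have "w = f (2 * pi) * g' (2 * pi) - f' (2 * pi) * g (2 * pi)"
    using wronskian_const[OF f(1) g(1), of 0 "2 * pi"] by (simp add: w_def algebra_simps)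
  also have "\<dots> = \<rho> * \<sigma> * w" unfolding per w_def by algebra
  finally have det: "\<rho> * \<sigma> = 1" using w by simp
  have "w * (u (2 * pi) + v' (2 * pi)) = w * (\<rho> + \<sigma>)"
    using sol_eq_fundamental[OF F f(1), of "2 * pi"] sol_eq_fundamental[OF F g(1), of "2 * pi"]
    unfolding per w_def by algebra
  then have "\<rho> + \<sigma> \<in> {2, -2}"
    using w disc hill_discriminant_eq[OF q F] by simp
  then have "(\<rho> - \<sigma>)\<^sup>2 = 0" using det by (auto simp: power2_eq_square) algebra+
  then have [simp]: "\<sigma> = \<rho>" by simp
  have "y (x + 2 * pi) = \<rho> * y x" if y: "solves ?p y y'" for y y' x
  proof -
    have "w * y t = (y 0 * g' 0 - y' 0 * g 0) * f t + (f 0 * y' 0 - f' 0 * y 0) * g t" for t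
      using sol_eq_fundamental(1)[OF F y, of t] sol_eq_fundamental(1)[OF F f(1), of t]
        sol_eq_fundamental(1)[OF F g(1), of t] unfolding w_def by algebra
    from this[of x] this[of "x + 2 * pi"] have "w * y (x + 2 * pi) = w * (\<rho> * y x)"
      unfolding f(2) g(2) \<open>\<sigma> = \<rho>\<close> by algebra
    with w show ?thesis by simp
  qed
  then show ?thesis by blast
qed

section \<open>Growth in the spectral parameter\<close>

text \<open>The function \<open>a + b * F\<close>, with \<open>F\<close> the integral of \<open>f\<close>, satisfies a differential inequality that
  makes its product with \<open>exp (- b * t)\<close> nonincreasing.\<close>

lemma gronwall:
  fixes f :: "real \<Rightarrow> real"
  assumes cont: "continuous_on UNIV f" and b: "b \<ge> 0"
    and le: "\<And>x. 0 \<le> x \<Longrightarrow> x \<le> X \<Longrightarrow> f x \<le> a + b * integral {0..x} f"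
    and x: "0 \<le> x" "x \<le> X"
  shows "f x \<le> a * exp (b * x)"
proof -
  obtain F where F0: "F 0 = 0" and F: "\<And>x. (F has_vector_derivative f x) (at x)"
    using antiderivative_on_line[OF cont] by blast
  have FI: "integral {0..t} f = F t" if "0 \<le> t" for t
    using fundamental_theorem_of_calculus[OF that, of F f] F F0
    by (intro integral_unique) (auto intro: has_vector_derivative_at_within)
  define E where "E = (\<lambda>t. (a + b * F t) * exp (- (b * t)))"
  have "E x \<le> E 0"
  proof (rule DERIV_nonpos_imp_nonincreasing[OF x(1)])
    fix t assume t: "0 \<le> t" "t \<le> x"
    have "(F has_real_derivative f t) (at t)"
      using F by (simp add: has_real_derivative_iff_has_vector_derivative)
    then have "(E has_real_derivative b * (f t - (a + b * F t)) * exp (- (b * t))) (at t)"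
      unfolding E_def by (auto intro!: derivative_eq_intros simp: algebra_simps)
    moreover have "b * (f t - (a + b * F t)) * exp (- (b * t)) \<le> 0"
      using le[of t] FI[of t] t x b by (intro mult_nonpos_nonneg mult_nonneg_nonpos) auto
    ultimately show "\<exists>y. (E has_real_derivative y) (at t) \<and> y \<le> 0" by blast
  qed
  then have "a + b * F x \<le> a * exp (b * x)"
    by (simp add: E_def F0 exp_minus field_simps)
  with le[OF x] FI[OF x(1)] show ?thesis by simp
qed

lemma cmod_sin_mult_le:
  assumes "0 \<le> s"
  shows "cmod (sin (k * of_real s)) \<le> exp (\<bar>Im k\<bar> * s)"
  using cmod_sin_le_exp[of 1 "k * of_real s"] assms by (simp add: abs_mult)

text \<open>Variation of constants around the zero potential: Green's formula for \<open>v\<close> and the solution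
  \<open>sin (k * (x - s)) / k\<close> of the free equation in \<open>s\<close>, which vanishes at \<open>s = x\<close> with derivative -1.\<close>

lemma sol_volterra_sine:
  assumes v: "solves (\<lambda>x. q x - k\<^sup>2) v v'" "v 0 = 0" "v' 0 = 1" and k: "k \<noteq> 0" and x: "0 \<le> x"
  shows "((\<lambda>s. q s * (k * v s) * (sin (k * of_real (x - s)) / k)) has_integral
           k * v x - sin (k * of_real x)) {0..x}"
proof -
  define w where "w = (\<lambda>s. sin (k * of_real (x - s)))"
  define w' where "w' = (\<lambda>s. - k * cos (k * of_real (x - s)))"
  have arg: "((\<lambda>s. k * of_real (x - s)) has_vector_derivative - k) (at s)" for s
    by (auto intro!: derivative_eq_intros simp: algebra_simps)
  have "(w has_vector_derivative w' s) (at s)" for s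
    using field_vector_diff_chain_at[OF arg DERIV_sin] by (simp add: w_def w'_def o_def)
  moreover have "((\<lambda>s. cos (k * of_real (x - s))) has_vector_derivative k * w s) (at s)" for s
    using field_vector_diff_chain_at[OF arg DERIV_cos] by (simp add: w_def o_def)
  then have "(w' has_vector_derivative - k\<^sup>2 * w s) (at s)" for s
    unfolding w'_def using has_vector_derivative_mult_right[of _ "k * w s" "at s" "- k"]
    by (simp add: power2_eq_square mult.assoc)
  ultimately have "solves (\<lambda>_. - k\<^sup>2) w w'" by (simp add: solves_def)
  from green_integral[OF v(1) this x] show ?thesis
    using v(2,3) k by (simp add: w_def w'_def algebra_simps)
qed

text \<open>The free kernel grows like \<open>exp (\<bar>Im k\<bar> * (x - s))\<close>. Weighting \<open>k * v\<close> by \<open>exp (- \<bar>Im k\<bar> * s)\<close> removes this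
  exponential from the Volterra equation, so Gronwall's inequality is applied with the small constant
  \<open>M / cmod k\<close>, and the difference from the free solution gains a factor \<open>1 / cmod k\<close>
  over its natural size \<open>exp (\<bar>Im k\<bar> * X)\<close>.\<close>

lemma sol_growth:
  assumes q: "continuous_on UNIV q" and M: "\<And>s. 0 \<le> s \<Longrightarrow> s \<le> X \<Longrightarrow> cmod (q s) \<le> M" "M \<ge> 0"
    and v: "solves (\<lambda>x. q x - k\<^sup>2) v v'" "v 0 = 0" "v' 0 = 1" and k: "k \<noteq> 0" and X: "0 \<le> X"
  shows "cmod (k * v X - sin (k * of_real X))
           \<le> M / cmod k * X * exp (M / cmod k * X) * exp (\<bar>Im k\<bar> * X)"
proof -
  define \<tau> where "\<tau> = \<bar>Im k\<bar>"
  define f where "f = (\<lambda>s. cmod (k * v s) * exp (- (\<tau> * s)))"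
  have vc: "continuous_on S v" for S by (rule sol_continuous[OF v(1)])
  have f_cont: "continuous_on S f" for S
    unfolding f_def by (intro continuous_intros vc)
  have err: "cmod (k * v x - sin (k * of_real x)) \<le> exp (\<tau> * x) * (M / cmod k * integral {0..x} f)"
    if x: "0 \<le> x" "x \<le> X" for x
  proof -
    let ?g = "\<lambda>s. q s * (k * v s) * (sin (k * of_real (x - s)) / k)"
    have I: "(?g has_integral k * v x - sin (k * of_real x)) {0..x}"
      by (rule sol_volterra_sine[OF v k x(1)])
    have "norm (integral {0..x} ?g) \<le> integral {0..x} (\<lambda>s. exp (\<tau> * x) * (M / cmod k) * f s)"
    proof (rule integral_norm_bound_integral)
      show "?g integrable_on {0..x}" using I by blast
      show "(\<lambda>s. exp (\<tau> * x) * (M / cmod k) * f s) integrable_on {0..x}"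
        by (intro integrable_continuous_real continuous_intros f_cont)
      fix s assume s: "s \<in> {0..x}"
      have "norm (?g s) = cmod (q s) * cmod (k * v s) * cmod (sin (k * of_real (x - s))) / cmod k"
        by (simp add: norm_mult norm_divide)
      also have "\<dots> \<le> M * cmod (k * v s) * exp (\<tau> * (x - s)) / cmod k"
        using s x M(1)[of s] cmod_sin_mult_le[of "x - s" k] M(2)
        by (intro divide_right_mono mult_mono) (auto simp: \<tau>_def)
      also have "\<dots> = exp (\<tau> * x) * (M / cmod k) * f s"
        by (simp add: f_def right_diff_distrib exp_diff exp_minus field_simps)
      finally show "norm (?g s) \<le> exp (\<tau> * x) * (M / cmod k) * f s" .
    qed
    then show ?thesis unfolding integral_unique[OF I] integral_mult_right by (simp only: mult.assoc)
  qed
  have f_le: "f x \<le> 1 * exp (M / cmod k * x)" if "0 \<le> x" "x \<le> X" for x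
  proof (rule gronwall[OF f_cont _ _ that])
    show "0 \<le> M / cmod k" using M(2) by simp
    fix x assume x: "0 \<le> x" "x \<le> X"
    have "cmod (k * v x) \<le> cmod (sin (k * of_real x)) + cmod (k * v x - sin (k * of_real x))"
      using norm_triangle_ineq[of "sin (k * of_real x)" "k * v x - sin (k * of_real x)"] by simp
    also have "\<dots> \<le> exp (\<tau> * x) + exp (\<tau> * x) * (M / cmod k * integral {0..x} f)"
      by (intro add_mono err x) (use cmod_sin_mult_le[of x k] x in \<open>simp add: \<tau>_def\<close>)
    finally show "f x \<le> 1 + M / cmod k * integral {0..x} f"
      by (simp add: f_def exp_minus field_simps)
  qed
  have "integral {0..X} f \<le> integral {0..X} (\<lambda>_. exp (M / cmod k * X))"
  proof (rule integral_le)
    fix s assume s: "s \<in> {0..X}"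
    have "f s \<le> exp (M / cmod k * s)" using f_le s by simp
    also have "\<dots> \<le> exp (M / cmod k * X)" using s M(2) by (simp add: divide_right_mono mult_left_mono)
    finally show "f s \<le> exp (M / cmod k * X)" .
  qed (auto intro: integrable_continuous_real f_cont)
  then have "integral {0..X} f \<le> X * exp (M / cmod k * X)" using X by simp
  then have "exp (\<tau> * X) * (M / cmod k * integral {0..X} f)
      \<le> exp (\<tau> * X) * (M / cmod k * (X * exp (M / cmod k * X)))"
    using M(2) by (intro mult_left_mono) auto
  with err[of X] X show ?thesis by (simp add: \<tau>_def mult_ac)
qed

section \<open>Dependence on the spectral parameter\<close>

lemma hill_v_sol:
  assumes "continuous_on UNIV q"
  shows "\<exists>v'. solves (\<lambda>x. q x - l) (hill_v q l) v' \<and> hill_v q l 0 = 0 \<and> v' 0 = 1"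
proof -
  have "continuous_on UNIV (\<lambda>x. q x - l)" by (intro continuous_intros assms)
  then obtain v v' where v: "solves (\<lambda>x. q x - l) v v'" "v 0 = 0" "v' 0 = 1"
    using sol_exists[of "\<lambda>x. q x - l" 0 1] by blast
  from hill_ivp_eq[OF assms v(1)] v show ?thesis by (auto simp: hill_v_def)
qed

lemma hill_v_eq:
  assumes "continuous_on UNIV q" "solves (\<lambda>x. q x - l) v v'" "v 0 = 0" "v' 0 = 1"
  shows "hill_v q l = v"
  using hill_ivp_eq[OF assms(1,2)] assms(3,4) by (simp add: hill_v_def)

text \<open>Variation of constants around the solutions at \<open>l\<close> itself: Green's formula expresses
  \<open>hill_v q m X - hill_v q l X\<close> as \<open>l - m\<close> times an integral of \<open>hill_v q m\<close> against the kernel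
  \<open>K X\<close> that belongs to \<open>l\<close>. Gronwall's inequality bounds \<open>hill_v q m\<close> for \<open>m\<close> near \<open>l\<close>; the same
  formula then shows that it tends to \<open>hill_v q l\<close>, so that the difference quotient converges.\<close>

lemma hill_v_differentiable:
  assumes q: "continuous_on UNIV q" and X: "0 \<le> X"
  shows "(\<lambda>l. hill_v q l X) field_differentiable (at l)"
proof -
  let ?v = "hill_v q"
  obtain u u' v v' where F: "fundamental (\<lambda>x. q x - l) u u' v v'"
    using fundamental_exists[OF continuous_on_diff[OF q continuous_on_const]] by blast
  have [simp]: "?v l = v" using hill_v_eq[OF q, of l v v'] F by (auto simp: fundamental_def)
  have uc: "continuous_on S u" and vc: "continuous_on S v" for S
    using F sol_continuous by (auto simp: fundamental_def)
  have mc: "continuous_on S (?v m)" for m S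
    using hill_v_sol[OF q, of m] sol_continuous by blast
  define K where "K = (\<lambda>x s. u s * v x - v s * u x)"
  have Kc: "continuous_on S (K x)" for x S
    unfolding K_def by (intro continuous_intros uc vc)
  have rep: "((\<lambda>s. (l - m) * (?v m s * K x s)) has_integral ?v m x - v x) {0..x}"
    if "0 \<le> x" for m x
  proof -
    obtain z where z: "solves (\<lambda>x. q x - m) (?v m) z" "?v m 0 = 0" "z 0 = 1"
      using hill_v_sol[OF q] by blast
    have "solves (\<lambda>x. q x - l) (K x) (\<lambda>s. u' s * v x - v' s * u x)"
      unfolding solves_def K_def
    proof safe
      fix s
      have "(u has_vector_derivative u' s) (at s)" "(u' has_vector_derivative (q s - l) * u s) (at s)"
        "(v has_vector_derivative v' s) (at s)" "(v' has_vector_derivative (q s - l) * v s) (at s)"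
        using F by (auto simp: fundamental_def solves_def)
      then show "((\<lambda>s. u s * v x - v s * u x) has_vector_derivative u' s * v x - v' s * u x) (at s)"
        "((\<lambda>s. u' s * v x - v' s * u x) has_vector_derivative
            (q s - l) * (u s * v x - v s * u x)) (at s)"
        by (auto intro!: derivative_eq_intros simp: algebra_simps)
    qed
    from green_integral[OF z(1) this that]
    have "((\<lambda>s. (l - m) * ?v m s * K x s) has_integral
        ?v m x * (u x * v' x - u' x * v x) - v x) {0..x}"
      using z(2,3) F by (simp add: K_def fundamental_def algebra_simps)
    then show ?thesis by (simp add: fundamental_wronskian[OF F] mult.assoc)
  qed
  have "compact (u ` {0..X} \<union> v ` {0..X})"
    by (intro compact_Un compact_continuous_image uc vc compact_Icc)
  then obtain B where B: "B > 0" "\<And>w. w \<in> u ` {0..X} \<union> v ` {0..X} \<Longrightarrow> norm w \<le> B"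
    using compact_imp_bounded bounded_pos by metis
  define G where "G = 2 * B\<^sup>2"
  have G: "G \<ge> 0" by (simp add: G_def)
  have K: "cmod (K x s) \<le> G" if "x \<in> {0..X}" "s \<in> {0..X}" for x s
  proof -
    have "cmod (K x s) \<le> cmod (u s) * cmod (v x) + cmod (v s) * cmod (u x)"
      unfolding K_def by (metis norm_triangle_ineq4 norm_mult)
    also have "\<dots> \<le> B * B + B * B"
      using that B by (intro add_mono mult_mono) auto
    finally show ?thesis by (simp add: G_def power2_eq_square)
  qed
  have diff_le: "cmod (?v m x - v x) \<le> cmod (m - l) * G * integral {0..x} (\<lambda>s. cmod (?v m s))"
    if x: "0 \<le> x" "x \<le> X" for m x
  proof -
    have "norm (integral {0..x} (\<lambda>s. (l - m) * (?v m s * K x s)))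
        \<le> integral {0..x} (\<lambda>s. cmod (m - l) * G * cmod (?v m s))"
    proof (rule integral_norm_bound_integral)
      show "(\<lambda>s. (l - m) * (?v m s * K x s)) integrable_on {0..x}" using rep[OF x(1)] by blast
      show "(\<lambda>s. cmod (m - l) * G * cmod (?v m s)) integrable_on {0..x}"
        by (intro integrable_continuous_real continuous_intros mc)
      fix s assume "s \<in> {0..x}"
      then have "cmod (m - l) * (cmod (?v m s) * cmod (K x s)) \<le> cmod (m - l) * (cmod (?v m s) * G)"
        using x K by (intro mult_left_mono) auto
      then show "norm ((l - m) * (?v m s * K x s)) \<le> cmod (m - l) * G * cmod (?v m s)"
        by (simp add: norm_mult norm_minus_commute mult_ac)
    qed
    then show ?thesis unfolding integral_unique[OF rep[OF x(1)]] by (simp only: integral_mult_right)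
  qed
  have v_le: "cmod (?v m x) \<le> B * exp (cmod (m - l) * G * x)" if x: "0 \<le> x" "x \<le> X" for m x
  proof (rule gronwall[OF _ _ _ x])
    show "continuous_on UNIV (\<lambda>x. cmod (?v m x))" by (intro continuous_intros mc)
    show "0 \<le> cmod (m - l) * G" using G by simp
    fix x assume x: "0 \<le> x" "x \<le> X"
    have "cmod (?v m x) \<le> cmod (v x) + cmod (?v m x - v x)"
      using norm_triangle_ineq[of "v x" "?v m x - v x"] by simp
    also have "\<dots> \<le> B + cmod (m - l) * G * integral {0..x} (\<lambda>s. cmod (?v m s))"
      using x B by (intro add_mono diff_le) auto
    finally show "cmod (?v m x) \<le> B + cmod (m - l) * G * integral {0..x} (\<lambda>s. cmod (?v m s))" .
  qed
  define C where "C = G * (X * (B * exp (G * X)))"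
  have C: "C \<ge> 0" using G X B by (simp add: C_def)
  have lip: "cmod (?v m x - v x) \<le> C * cmod (m - l)"
    if x: "0 \<le> x" "x \<le> X" and m: "cmod (m - l) \<le> 1" for m x
  proof -
    have "integral {0..x} (\<lambda>s. cmod (?v m s)) \<le> integral {0..x} (\<lambda>_. B * exp (G * X))"
    proof (rule integral_le)
      fix s assume s: "s \<in> {0..x}"
      have "cmod (m - l) * G * s \<le> 1 * G * X"
        using m s x G by (intro mult_mono) auto
      then have "B * exp (cmod (m - l) * G * s) \<le> B * exp (G * X)" using B by simp
      with v_le[of s m] s x show "cmod (?v m s) \<le> B * exp (G * X)" by auto
    qed (auto intro!: integrable_continuous_real continuous_intros mc)
    also have "\<dots> \<le> X * (B * exp (G * X))" using x B by (simp add: mult_right_mono)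
    finally have "cmod (m - l) * G * integral {0..x} (\<lambda>s. cmod (?v m s)) \<le> cmod (m - l) * G * (X * (B * exp (G * X)))"
      using G by (intro mult_left_mono) auto
    with diff_le[OF x, of m] show ?thesis by (simp add: C_def mult_ac)
  qed
  define D where "D = - integral {0..X} (\<lambda>s. v s * K X s)"
  have quot: "cmod ((?v m X - v X) / (m - l) - D) \<le> X * G * C * cmod (m - l)"
    if m: "cmod (m - l) \<le> 1" "m \<noteq> l" for m
  proof -
    have "(l - m) * integral {0..X} (\<lambda>s. ?v m s * K X s) = ?v m X - v X"
      unfolding integral_unique[OF rep[OF X], symmetric] by (simp only: integral_mult_right)
    then have "(?v m X - v X) / (m - l) = - integral {0..X} (\<lambda>s. ?v m s * K X s)"
      using m by (simp add: field_simps del: integral_mult_right)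
    then have "(?v m X - v X) / (m - l) - D
        = - (integral {0..X} (\<lambda>s. ?v m s * K X s) - integral {0..X} (\<lambda>s. v s * K X s))"
      by (simp add: D_def)
    also have "\<dots> = - integral {0..X} (\<lambda>s. ?v m s * K X s - v s * K X s)"
      by (subst integral_diff) (auto intro!: integrable_continuous_real continuous_intros mc Kc vc)
    finally have "cmod ((?v m X - v X) / (m - l) - D)
        = norm (integral {0..X} (\<lambda>s. ?v m s * K X s - v s * K X s))" by simp
    also have "\<dots> \<le> integral {0..X} (\<lambda>s. C * cmod (m - l) * G)"
    proof (rule integral_norm_bound_integral)
      fix s assume s: "s \<in> {0..X}"
      have "norm (?v m s * K X s - v s * K X s) = cmod (?v m s - v s) * cmod (K X s)"
        by (metis left_diff_distrib norm_mult)
      also have "\<dots> \<le> C * cmod (m - l) * G"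
        using s X m G C by (intro mult_mono lip K) auto
      finally show "norm (?v m s * K X s - v s * K X s) \<le> C * cmod (m - l) * G" .
    qed (auto intro!: integrable_continuous_real continuous_intros mc Kc vc)
    finally show ?thesis using X by (simp add: mult_ac)
  qed
  have "((\<lambda>m. (?v m X - v X) / (m - l) - D) \<longlongrightarrow> 0) (at l)"
  proof (rule Lim_null_comparison)
    show "\<forall>\<^sub>F m in at l. norm ((?v m X - v X) / (m - l) - D) \<le> X * G * C * cmod (m - l)"
      unfolding eventually_at by (intro exI[of _ 1]) (auto simp: dist_norm intro!: quot)
    show "((\<lambda>m. X * G * C * cmod (m - l)) \<longlongrightarrow> 0) (at l)"
      by (auto intro!: tendsto_eq_intros)
  qed
  then have "((\<lambda>l. ?v l X) has_field_derivative D) (at l)"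
    unfolding has_field_derivative_iff using LIM_zero_iff by fastforce
  then show ?thesis by (auto simp: field_differentiable_def)
qed

section \<open>An entire function with the zeros of the sine\<close>

text \<open>At a zero both functions are divided by the linear factor; the denominator is then nonzero
  because the zero is simple.\<close>

lemma entire_quotient_simple_zeros:
  assumes f: "f holomorphic_on UNIV" and s: "s holomorphic_on UNIV"
    and simple: "\<And>z. s z = 0 \<Longrightarrow> deriv s z \<noteq> 0" and zeros: "\<And>z. s z = 0 \<Longrightarrow> f z = 0"
  shows "\<exists>h. h holomorphic_on UNIV \<and> (\<forall>z. f z = h z * s z)"
proof -
  define h where "h = (\<lambda>z. if s z = 0 then deriv f z / deriv s z else f z / s z)"
  have "h field_differentiable at z0" for z0
  proof (cases "s z0 = 0")
    case False
    define U where "U = s -` (- {0})"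
    have "open U" unfolding U_def
      using holomorphic_on_imp_continuous_on[OF s] by (intro open_vimage) auto
    moreover have "(\<lambda>z. f z / s z) holomorphic_on U"
      by (intro holomorphic_intros holomorphic_on_subset[OF f] holomorphic_on_subset[OF s]) (auto simp: U_def)
    then have "h holomorphic_on U"
      by (rule holomorphic_transform) (auto simp: h_def U_def)
    ultimately show ?thesis using False by (auto simp: holomorphic_on_open field_differentiable_def U_def)
  next
    case True
    define f1 where "f1 = (\<lambda>z. if z = z0 then deriv f z0 else f z / (z - z0) - f z0 / (z - z0))"
    define s1 where "s1 = (\<lambda>z. if z = z0 then deriv s z0 else s z / (z - z0) - s z0 / (z - z0))"
    have f1: "f1 holomorphic_on UNIV" unfolding f1_def by (rule pole_theorem[OF f]) auto
    have s1: "s1 holomorphic_on UNIV" unfolding s1_def by (rule pole_theorem[OF s]) auto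
    define U where "U = s1 -` (- {0})"
    have "open U" unfolding U_def
      using holomorphic_on_imp_continuous_on[OF s1] by (intro open_vimage) auto
    moreover have "z0 \<in> U" using simple[OF True] by (auto simp: U_def s1_def)
    moreover have "(\<lambda>z. f1 z / s1 z) holomorphic_on U"
      by (intro holomorphic_intros holomorphic_on_subset[OF f1] holomorphic_on_subset[OF s1]) (auto simp: U_def)
    then have "h holomorphic_on U"
      by (rule holomorphic_transform)
         (auto simp: h_def U_def f1_def s1_def True zeros split: if_splits)
    ultimately show ?thesis by (auto simp: holomorphic_on_open field_differentiable_def)
  qed
  then have "h holomorphic_on UNIV" by (simp add: holomorphic_on_def)
  moreover have "f z = h z * s z" for z using zeros by (simp add: h_def)
  ultimately show ?thesis by blast
qed

text \<open>The sine has its full exponential size away from its zeros: on the vertical lines halfway between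
  them, and at distance at least 1 from the real axis.\<close>

lemma exp_le_cmod_sin:
  assumes "cos (2 * Re z) = -1 \<or> \<bar>Im z\<bar> \<ge> 1"
  shows "exp \<bar>Im z\<bar> \<le> 4 * cmod (sin z)"
proof (rule power2_le_imp_le)
  define E where "E = exp (2 * \<bar>Im z\<bar>)"
  have E: "E > 0" by (simp add: E_def)
  have "E + inverse E = exp (2 * Im z) + inverse (exp (2 * Im z))"
    by (cases "Im z \<ge> 0") (auto simp: E_def exp_minus)
  then have eq: "(4 * cmod (sin z))\<^sup>2 = 4 * (E + inverse E - 2 * cos (2 * Re z))"
    by (simp add: power_mult_distrib norm_sin_squared)
  have "E \<le> 4 * (E + inverse E - 2 * cos (2 * Re z))"
    using assms
  proof
    assume "cos (2 * Re z) = -1"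
    then show ?thesis using E by simp
  next
    assume "1 \<le> \<bar>Im z\<bar>"
    have "1 + 2 * \<bar>Im z\<bar> \<le> E" unfolding E_def by (rule exp_ge_add_one_self)
    with \<open>1 \<le> \<bar>Im z\<bar>\<close> have "3 \<le> E" by linarith
    moreover have "cos (2 * Re z) \<le> 1" "inverse E > 0" using E by auto
    ultimately show ?thesis by argo
  qed
  then show "(exp \<bar>Im z\<bar>)\<^sup>2 \<le> (4 * cmod (sin z))\<^sup>2"
    unfolding eq by (simp add: E_def exp_double)
qed simp

text \<open>Both sides vanish at all half-integers, which are the zeros of the sine and simple, so their
  quotient \<open>h\<close> is entire. By \<open>sol_growth\<close> and \<open>exp_le_cmod_sin\<close>, \<open>h - 1\<close> is at most \<open>C / r\<close> on the boundary of the
  square of half-side \<open>r = (2 * N + 1) / 4\<close>, whose vertical sides run halfway between zeros. The maximum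
  principle carries this bound inside, and \<open>N\<close> is arbitrary.\<close>

lemma hill_v_eq_sine:
  assumes q: "continuous_on UNIV q"
    and zeros: "\<And>n::nat. n \<ge> 1 \<Longrightarrow> hill_v q (of_real ((real n)\<^sup>2 / 4)) (2 * pi) = 0"
  shows "k * hill_v q (k\<^sup>2) (2 * pi) = sin (2 * of_real pi * k)"
proof -
  define F where "F = (\<lambda>k. k * hill_v q (k\<^sup>2) (2 * pi))"
  define s :: "complex \<Rightarrow> complex" where "s = (\<lambda>k. sin (2 * of_real pi * k))"
  have "(\<lambda>l. hill_v q l (2 * pi)) holomorphic_on UNIV"
    using hill_v_differentiable[OF q] by (simp add: holomorphic_on_def)
  then have "((\<lambda>l. hill_v q l (2 * pi)) \<circ> (\<lambda>k. k\<^sup>2)) holomorphic_on UNIV"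
    by (intro holomorphic_on_compose holomorphic_intros) (auto elim: holomorphic_on_subset)
  then have F_hol: "F holomorphic_on UNIV"
    unfolding F_def o_def by (intro holomorphic_intros)
  have s_hol: "s holomorphic_on UNIV" unfolding s_def by (intro holomorphic_intros)
  have F_zero: "F z = 0" if sz: "s z = 0" for z
  proof -
    obtain n :: int where "2 * of_real pi * z = of_real (n * pi)"
      using sz unfolding s_def sin_eq_0 by blast
    then have "2 * of_real pi * z = 2 * of_real pi * of_real (real_of_int n / 2)" by simp
    then have z: "z = of_real (real_of_int n / 2)" by (subst (asm) mult_cancel_left) simp
    show ?thesis
    proof (cases "n = 0")
      case False
      have "z\<^sup>2 = of_real ((real (nat \<bar>n\<bar>))\<^sup>2 / 4)" by (simp add: z power_divide)
      moreover have "nat \<bar>n\<bar> \<ge> 1" using False by linarith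
      ultimately show ?thesis using zeros[of "nat \<bar>n\<bar>"] by (simp only: F_def mult_zero_right)
    qed (simp add: F_def z)
  qed
  have s_simple: "deriv s z \<noteq> 0" if "s z = 0" for z
  proof -
    have "(s has_field_derivative cos (2 * of_real pi * z) * (2 * of_real pi)) (at z)"
      unfolding s_def by (auto intro!: derivative_eq_intros)
    moreover have "cos (2 * of_real pi * z) \<noteq> 0"
      using that sin_cos_squared_add[of "2 * of_real pi * z"] by (auto simp: s_def)
    ultimately show ?thesis by (simp add: DERIV_imp_deriv)
  qed
  obtain h where h: "h holomorphic_on UNIV" and hs: "\<And>z. F z = h z * s z"
    using entire_quotient_simple_zeros[OF F_hol s_hol s_simple F_zero] by blast
  have "compact (q ` {0..2 * pi})"
    by (intro compact_continuous_image continuous_on_subset[OF q]) auto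
  then obtain M where M: "M > 0" "\<And>w. w \<in> q ` {0..2 * pi} \<Longrightarrow> norm w \<le> M"
    using compact_imp_bounded bounded_pos by metis
  define C where "C = 4 * (M * (2 * pi) * exp (M * (2 * pi)))"
  have C: "C > 0" using M by (simp add: C_def)
  have h_near_1: "cmod (h z - 1) \<le> C / cmod z"
    if z: "cmod z \<ge> 1" and sz: "exp (\<bar>Im z\<bar> * (2 * pi)) \<le> 4 * cmod (s z)" for z
  proof -
    have z0: "z \<noteq> 0" using z by auto
    obtain v' where v': "solves (\<lambda>x. q x - z\<^sup>2) (hill_v q (z\<^sup>2)) v'" "hill_v q (z\<^sup>2) 0 = 0" "v' 0 = 1"
      using hill_v_sol[OF q] by blast
    have Mz: "M / cmod z \<le> M" using z M by (simp add: divide_le_eq)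
    then have Mz': "M / cmod z * (2 * pi) \<le> M * (2 * pi)" by (intro mult_right_mono) auto
    have "cmod (F z - s z)
        \<le> M / cmod z * (2 * pi) * exp (M / cmod z * (2 * pi)) * exp (\<bar>Im z\<bar> * (2 * pi))"
      using sol_growth[OF q _ _ v' z0, of "2 * pi" M] M by (simp add: F_def s_def mult_ac)
    also have "\<dots> \<le> M / cmod z * (2 * pi) * exp (M * (2 * pi)) * (4 * cmod (s z))"
      using Mz' M sz by (intro mult_mono) auto
    also have "\<dots> = C / cmod z * cmod (s z)" by (simp add: C_def)
    finally have "cmod (h z - 1) * cmod (s z) \<le> C / cmod z * cmod (s z)"
      by (simp add: hs flip: norm_mult left_diff_distrib) (simp add: algebra_simps norm_mult[symmetric])
    moreover have "cmod (s z) > 0" using sz exp_gt_zero[of "\<bar>Im z\<bar> * (2 * pi)"] by linarith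
    ultimately show ?thesis by (rule mult_right_le_imp_le)
  qed
  have h1: "h z = 1" for z
  proof (rule ccontr)
    assume "h z \<noteq> 1"
    then have d: "cmod (h z - 1) > 0" by simp
    obtain N :: nat where N: "real N > 2 + 2 * cmod z + 4 * (C / cmod (h z - 1))"
      using reals_Archimedean2 by blast
    \<comment> \<open>Half-way between two consecutive half-integers, so that the sine is large on the vertical sides.\<close>
    define r where "r = (2 * real N + 1) / 4"
    have "C / cmod (h z - 1) > 0" using C d by simp
    then have "r > 1 \<and> r > cmod z \<and> r > C / cmod (h z - 1)"
      using N norm_ge_zero[of z] unfolding r_def by argo
    then have r: "r > 1" "r > cmod z" "r > C / cmod (h z - 1)" by auto
    define Q where "Q = cbox (Complex (- r) (- r)) (Complex r r)"
    have Qmem: "w \<in> Q \<longleftrightarrow> \<bar>Re w\<bar> \<le> r \<and> \<bar>Im w\<bar> \<le> r" for w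
      by (auto simp: Q_def in_cbox_complex_iff)
    have "cmod (h z - 1) \<le> C / r"
    proof (rule maximum_modulus_frontier[of "\<lambda>z. h z - 1" Q])
      show "(\<lambda>z. h z - 1) holomorphic_on interior Q"
        by (intro holomorphic_intros holomorphic_on_subset[OF h]) auto
      show "continuous_on (closure Q) (\<lambda>z. h z - 1)"
        by (intro continuous_intros continuous_on_subset[OF holomorphic_on_imp_continuous_on[OF h]]) auto
      show "bounded Q" by (simp add: Q_def)
      show "z \<in> Q" using abs_Re_le_cmod[of z] abs_Im_le_cmod[of z] r by (simp add: Qmem)
      fix w assume w: "w \<in> frontier Q"
      have side: "\<bar>Re w\<bar> = r \<or> \<bar>Im w\<bar> = r"
      proof (rule ccontr)
        assume *: "\<not> (\<bar>Re w\<bar> = r \<or> \<bar>Im w\<bar> = r)"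
        have "w \<in> Q" using w frontier_subset_closed[of Q] by (auto simp: Q_def)
        with * have "w \<in> box (Complex (- r) (- r)) (Complex r r)"
          by (auto simp: Qmem in_box_complex_iff)
        then show False using w by (simp add: Q_def frontier_cbox)
      qed
      then have wr: "cmod w \<ge> r" using abs_Re_le_cmod[of w] abs_Im_le_cmod[of w] by auto
      have "exp \<bar>Im (2 * of_real pi * w)\<bar> \<le> 4 * cmod (sin (2 * of_real pi * w))"
      proof (rule exp_le_cmod_sin)
        show "cos (2 * Re (2 * of_real pi * w)) = -1 \<or> 1 \<le> \<bar>Im (2 * of_real pi * w)\<bar>"
          using side
        proof
          assume "\<bar>Re w\<bar> = r"
          have "cos (2 * Re (2 * of_real pi * w)) = cos (4 * pi * \<bar>Re w\<bar>)"
            by (cases "Re w \<ge> 0") (auto simp: algebra_simps)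
          also have "4 * pi * \<bar>Re w\<bar> = 2 * real N * pi + pi"
            unfolding \<open>\<bar>Re w\<bar> = r\<close> r_def by (simp add: field_simps)
          also have "cos \<dots> = -1" using cos_npi[of "2 * N + 1"] by (simp add: algebra_simps)
          finally show ?thesis ..
        next
          assume Im: "\<bar>Im w\<bar> = r"
          have "1 * 1 \<le> (2 * pi) * r" using r pi_gt3 by (intro mult_mono) auto
          then show ?thesis using Im by (simp add: abs_mult)
        qed
      qed
      then have "cmod (h w - 1) \<le> C / cmod w"
        using wr r by (intro h_near_1) (auto simp: s_def abs_mult mult_ac)
      also have "\<dots> \<le> C / r" using wr r C by (intro divide_left_mono mult_pos_pos) linarith+
      finally show "cmod (h w - 1) \<le> C / r" .
    qed
    also have "C / r < cmod (h z - 1)" using r d by (simp add: field_simps)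
    finally show False by simp
  qed
  show ?thesis using hs[of k] h1[of k] by (simp add: F_def s_def)
qed

section \<open>Translating the potential\<close>

text \<open>As a function of \<open>x\<close>, the right-hand side is the solution that vanishes at the point \<open>t\<close> with
  derivative equal to the Wronskian 1.\<close>

lemma hill_v_shift:
  assumes q: "continuous_on UNIV q" and F: "fundamental (\<lambda>x. q x - l) u u' v v'"
  shows "hill_v (\<lambda>x. q (x + t)) l x = u t * v (x + t) - v t * u (x + t)"
proof -
  have "continuous_on UNIV (\<lambda>x. q (x + t))"
    by (rule continuous_on_compose2[OF q]) (auto intro: continuous_intros)
  moreover have "solves (\<lambda>x. q (x + t) - l) (\<lambda>x. u t * v (x + t) - v t * u (x + t))
      (\<lambda>x. u t * v' (x + t) - v t * u' (x + t))"
  proof -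
    have "solves (\<lambda>x. q (x + t) - l) (\<lambda>x. u (x + t)) (\<lambda>x. u' (x + t))"
      "solves (\<lambda>x. q (x + t) - l) (\<lambda>x. v (x + t)) (\<lambda>x. v' (x + t))"
      using F sol_shift unfolding fundamental_def by auto
    then show ?thesis unfolding solves_def
      by (auto intro!: derivative_eq_intros simp: algebra_simps)
  qed
  ultimately have "hill_v (\<lambda>x. q (x + t)) l = (\<lambda>x. u t * v (x + t) - v t * u (x + t))"
    by (rule hill_v_eq) (use fundamental_wronskian[OF F, of t] in \<open>auto simp: algebra_simps\<close>)
  then show ?thesis by simp
qed

text \<open>Solutions that vanish at \<open>t\<close> vanish again at \<open>t + 2 * pi\<close>, whatever \<open>t\<close> is; this is how
  coexistence enters.\<close>

lemma coexistence_hill_v_shift: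
  assumes q: "continuous_on UNIV q" and co: "coexistence q l"
  shows "hill_v (\<lambda>x. q (x + t)) l (2 * pi) = 0"
proof -
  have q_t: "continuous_on UNIV (\<lambda>x. q (x + t))"
    by (rule continuous_on_compose2[OF q]) (auto intro: continuous_intros)
  obtain w' where w: "solves (\<lambda>x. q (x + t) - l) (hill_v (\<lambda>x. q (x + t)) l) w'"
      "hill_v (\<lambda>x. q (x + t)) l 0 = 0"
    using hill_v_sol[OF q_t] by blast
  obtain \<rho> where \<rho>: "\<And>y y' x. solves (\<lambda>x. q x - l) y y' \<Longrightarrow> y (x + 2 * pi) = \<rho> * y x"
    using coexistence_multiplier[OF q co] by blast
  have "solves (\<lambda>x. q x - l) (\<lambda>x. hill_v (\<lambda>x. q (x + t)) l (x + - t)) (\<lambda>x. w' (x + - t))"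
    using sol_shift[OF w(1), of "- t"] by simp
  from \<rho>[OF this, of t] w(2) show ?thesis by simp
qed

text \<open>By \<open>hill_v_shift\<close> the hypothesis says that \<open>u t * V t - v t * U t\<close> is constant, where \<open>U\<close> and \<open>V\<close> are
  the translates of \<open>u\<close> and \<open>v\<close> by a period and solve the same equation by periodicity. Its second
  derivative vanishes, which gives \<open>c * (q t - l) = v' t * U' t - u' t * V' t\<close>. The derivative of this
  right-hand side is a multiple of the first derivative of the constant, so it vanishes too.\<close>

lemma constant_potential:
  assumes q: "continuous_on UNIV q" and periodic: "\<And>x. q (x + 2 * pi) = q x"
    and const: "\<And>t. hill_v (\<lambda>x. q (x + t)) l (2 * pi) = c" and c: "c \<noteq> 0"
  shows "q x = q y"
proof -
  let ?p = "\<lambda>x. q x - l"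
  obtain u u' v v' where F: "fundamental ?p u u' v v'"
    using fundamental_exists[OF continuous_on_diff[OF q continuous_on_const]] by blast
  define U where "U = (\<lambda>x. u (x + 2 * pi))"
  define U' where "U' = (\<lambda>x. u' (x + 2 * pi))"
  define V where "V = (\<lambda>x. v (x + 2 * pi))"
  define V' where "V' = (\<lambda>x. v' (x + 2 * pi))"
  have sols: "solves ?p u u'" "solves ?p v v'" "solves ?p U U'" "solves ?p V V'"
    using F sol_shift[of ?p u u' "2 * pi"] sol_shift[of ?p v v' "2 * pi"]
    by (auto simp: fundamental_def periodic U_def U'_def V_def V'_def)
  have d: "(u has_vector_derivative u' t) (at t)" "(u' has_vector_derivative ?p t * u t) (at t)"
    "(v has_vector_derivative v' t) (at t)" "(v' has_vector_derivative ?p t * v t) (at t)"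
    "(U has_vector_derivative U' t) (at t)" "(U' has_vector_derivative ?p t * U t) (at t)"
    "(V has_vector_derivative V' t) (at t)" "(V' has_vector_derivative ?p t * V t) (at t)" for t
    using sols by (auto simp: solves_def)
  have W0: "u t * V t - v t * U t = c" for t
    using const[of t] unfolding hill_v_shift[OF q F] by (simp add: U_def V_def add.commute)
  have derivative_zero: "g' = 0"
    if "(g has_vector_derivative g') (at t)" "\<And>t. g t = b" for g :: "real \<Rightarrow> complex" and g' b t
  proof -
    have "g = (\<lambda>_. b)" using that(2) by auto
    with that(1) show ?thesis
      using vector_derivative_unique_at[OF _ has_vector_derivative_const] by blast
  qed
  have W1: "u' t * V t + u t * V' t - v' t * U t - v t * U' t = 0" for t
  proof (rule derivative_zero[OF _ W0])
    show "((\<lambda>t. u t * V t - v t * U t) has_vector_derivative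
        u' t * V t + u t * V' t - v' t * U t - v t * U' t) (at t)"
      by (auto intro!: derivative_eq_intros d simp: algebra_simps)
  qed
  have W2: "2 * ?p t * (u t * V t - v t * U t) + 2 * (u' t * V' t - v' t * U' t) = 0" for t
  proof (rule derivative_zero[OF _ W1])
    show "((\<lambda>t. u' t * V t + u t * V' t - v' t * U t - v t * U' t) has_vector_derivative
        2 * ?p t * (u t * V t - v t * U t) + 2 * (u' t * V' t - v' t * U' t)) (at t)"
      by (auto intro!: derivative_eq_intros d simp: algebra_simps)
  qed
  have p_eq: "c * ?p t = v' t * U' t - u' t * V' t" for t
    using W2[of t] unfolding W0 by algebra
  have "((\<lambda>t. v' t * U' t - u' t * V' t) has_vector_derivative
      - ?p t * (u' t * V t + u t * V' t - v' t * U t - v t * U' t)) (at t)" for t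
    by (auto intro!: derivative_eq_intros d simp: algebra_simps)
  then have "((\<lambda>t. v' t * U' t - u' t * V' t) has_vector_derivative 0) (at t)" for t
    by (simp add: W1)
  then have "v' x * U' x - u' x * V' x = v' y * U' y - u' y * V' y"
    by (rule zero_derivative_const[of "\<lambda>t. v' t * U' t - u' t * V' t"])
  then have "c * ?p x = c * ?p y" unfolding p_eq .
  with c show ?thesis by simp
qed

section \<open>Vanishing of the potential\<close>

theorem mainTheorem1:
  fixes q :: "real \<Rightarrow> complex"
  assumes periodic: "\<And>x. q (x + 2 * pi) = q x"
    and C2: "q C1_differentiable_on UNIV"
            "(\<lambda>x. vector_derivative q (at x)) C1_differentiable_on UNIV"
    and spectrum: "op_spectrum (hill_operator q) = complex_of_real ` {0..}"
    and coex: "\<And>n::nat. n \<ge> 1 \<Longrightarrow> coexistence q (complex_of_real ((real n)\<^sup>2 / 4))"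
  shows "\<forall>x. q x = 0"
proof -
  have q: "continuous_on UNIV q" by (rule C1_differentiable_imp_continuous_on[OF C2(1)])
  have sine: "k * hill_v (\<lambda>x. q (x + t)) (k\<^sup>2) (2 * pi) = sin (2 * of_real pi * k)" for k t
  proof (rule hill_v_eq_sine)
    show "continuous_on UNIV (\<lambda>x. q (x + t))"
      by (rule continuous_on_compose2[OF q]) (auto intro: continuous_intros)
    show "hill_v (\<lambda>x. q (x + t)) (of_real ((real n)\<^sup>2 / 4)) (2 * pi) = 0" if "n \<ge> 1" for n
      by (rule coexistence_hill_v_shift[OF q coex[OF that]])
  qed
  \<comment> \<open>Any parameter off the zeros of the sine gives a nonzero constant here; 1/4 makes the sine equal to 1.\<close>
    have "hill_v (\<lambda>x. q (x + t)) ((1/4)\<^sup>2) (2 * pi) = 4" for t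
  proof -
    have "2 * of_real pi * (1/4) = (of_real (pi / 2) :: complex)" by simp
    then have "sin (2 * of_real pi * (1/4)) = (1 :: complex)"
      by (simp only: sin_of_real sin_pi_half of_real_1)
    with sine[of "1/4" t] show ?thesis by simp
  qed
  then have const: "q x = q 0" for x
    by (intro constant_potential[OF q periodic]) auto
  define c where "c = q 0"
  have integer: "\<exists>j::nat. 4 * c = of_int ((int j)\<^sup>2 - (int n)\<^sup>2)" if n: "n \<ge> 1" for n :: nat
  proof -
    \<comment> \<open>The parameter at which subtracting the constant potential leaves the free equation with a Dirichlet eigenvalue.\<close>
        define k where "k = csqrt (c + (of_nat n / 2)\<^sup>2)"
    have k2: "k\<^sup>2 = c + (of_nat n / 2)\<^sup>2" by (simp add: k_def)
    have "q = (\<lambda>_. c)" using const by (auto simp: c_def)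
    then have "(\<lambda>x. q x - k\<^sup>2) = (\<lambda>x. 0 - (of_nat n / 2)\<^sup>2)" by (simp add: k2)
    then obtain v' where v: "solves (\<lambda>x. 0 - (of_nat n / 2)\<^sup>2) (hill_v q (k\<^sup>2)) v'"
        "hill_v q (k\<^sup>2) 0 = 0" "v' 0 = 1"
      using hill_v_sol[OF q, of "k\<^sup>2"] by auto
    have "of_nat n / 2 * hill_v q (k\<^sup>2) (2 * pi) - sin (of_nat n / 2 * of_real (2 * pi)) = 0"
      using sol_volterra_sine[OF v, of "2 * pi"] n by (simp add: has_integral_0_eq)
    moreover have "sin (of_nat n / 2 * of_real (2 * pi)) = (0 :: complex)"
      unfolding sin_eq_0 by (rule exI[of _ "int n"]) simp
    ultimately have "hill_v q (k\<^sup>2) (2 * pi) = 0" using n by simp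
    then have "sin (2 * of_real pi * k) = 0" using sine[of k 0] by simp
    then obtain i :: int where "2 * of_real pi * k = of_real (i * pi)" unfolding sin_eq_0 by blast
    then have "of_real pi * (2 * k) = of_real pi * of_int i" by simp
    then have "2 * k = of_int i" by (subst (asm) mult_cancel_left) simp
    then have "(2 * k)\<^sup>2 = (of_int i)\<^sup>2" by (simp only:)
    then have "4 * k\<^sup>2 = (of_int i)\<^sup>2" by (simp add: power_mult_distrib)
    then have "4 * (c + (of_nat n / 2)\<^sup>2) = (of_int i)\<^sup>2" unfolding k2 .
    then have "4 * c = (of_int i)\<^sup>2 - (of_nat n)\<^sup>2"
      by (simp add: power_divide distrib_left eq_diff_eq)
    then have "4 * c = of_int ((int (nat \<bar>i\<bar>))\<^sup>2 - (int n)\<^sup>2)" by simp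
    then show ?thesis by blast
  qed
  have "c = 0"
  proof (rule ccontr)
    assume "c \<noteq> 0"
    \<comment> \<open>Distinct squares, one of them \<open>n\<^sup>2\<close>, differ by at least \<open>n\<close>.\<close>
        obtain n :: nat where n: "real n > cmod (4 * c)" using reals_Archimedean2 by blast
    have "n \<ge> 1" using n norm_ge_zero[of "4 * c"] by linarith
    then obtain j :: nat where j: "4 * c = of_int ((int j)\<^sup>2 - (int n)\<^sup>2)" using integer by blast
    have "j \<noteq> n" using j \<open>c \<noteq> 0\<close> by auto
    then have "\<bar>int j - int n\<bar> \<ge> 1" by linarith
    then have "1 * int n \<le> \<bar>int j - int n\<bar> * (int j + int n)" by (intro mult_mono) auto
    also have "\<dots> = \<bar>(int j)\<^sup>2 - (int n)\<^sup>2\<bar>"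
      by (simp add: power2_eq_square square_diff_square_factored abs_mult mult.commute)
    also have "real_of_int \<dots> = cmod (4 * c)" unfolding j norm_of_int by simp
    finally show False using n by simp
  qed
  with const show ?thesis by (simp add: c_def)
qed

end
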